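(* Let $p$ be a prime, let $k\ge 1$, and let $M$ be a finite loopless matroid representable over $\mathbb{F}_{p^k}$. If $a(M)\le k$, then $\chi_M(p^k)>0$.
   Context: For a finite loopless matroid $M$, $\operatorname{si}(M)$ denotes its simplification (one element kept from each parallel class), and $a(M)$ is the least number of independent sets of $\operatorname{si}(M)$ needed to cover the ground set $E(\operatorname{si}(M))$; thus $a(M)=0$ when the ground set is empty. If $M$ has rank $n$ and rank function $\operatorname{rk}_M$, its characteristic polynomial is \[ \chi_M(t)=\sum_{A\subseteq E(M)}(-1)^{|A|}t^{\,n-\operatorname{rk}_M(A)}. \] *)

theory Defs
  imports
    "HOL-Library.Function_Algebras"
    "HOL-Library.Cardinality"
    "HOL-Computational_Algebra.Polynomial"
    "HOL-Computational_Algebra.Primes"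
begin

locale matroid =
  fixes E :: "'a set" and indep :: "'a set \<Rightarrow> bool"
  assumes finite_ground: "finite E"
    and indep_subset_ground: "indep X \<Longrightarrow> X \<subseteq> E"
    and indep_empty: "indep {}"
    and indep_subset: "indep X \<Longrightarrow> Y \<subseteq> X \<Longrightarrow> indep Y"
    and augment: "indep X \<Longrightarrow> indep Y \<Longrightarrow> card X < card Y \<Longrightarrow>
      \<exists>y\<in>Y - X. indep (insert y X)"
begin

definition rk :: "'a set \<Rightarrow> nat" where
  "rk A = Max (card ` {X. X \<subseteq> A \<and> indep X})"

text \<open>The exponents are differences of natural numbers; no truncation occurs,
  because \<open>rk A \<le> rk E\<close> for \<open>A \<subseteq> E\<close>.\<close>

definition char_poly :: "int poly" where
  "char_poly = (\<Sum>A\<in>Pow E. monom ((- 1) ^ card A) (rk E - rk A))"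

text \<open>The covering sets are an indexed family, so repetitions are allowed; this does not
  affect the minimum.  If some element is a loop, no cover exists and the value is unspecified.\<close>

definition covering_number :: nat where
  "covering_number = (LEAST m. \<exists>I :: nat \<Rightarrow> 'a set.
     (\<forall>i<m. indep (I i)) \<and> E \<subseteq> (\<Union>i<m. I i))"

end

text \<open>Vectors of \<open>F\<^sup>m\<close> are encoded as functions \<open>nat \<Rightarrow> 'f\<close> vanishing at all indices
  \<open>\<ge> m\<close>, with the pointwise operations.  The vectors \<open>v e\<close> form a family: a set containing two
  elements with the same vector is dependent, hence the injectivity condition.\<close>

definition representable_over :: "'f::field itself \<Rightarrow> 'a set \<Rightarrow> ('a set \<Rightarrow> bool) \<Rightarrow> bool" where
  "representable_over _ E indep \<longleftrightarrow>
     (\<exists>(m::nat) (v :: 'a \<Rightarrow> nat \<Rightarrow> 'f).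
        (\<forall>e\<in>E. \<forall>i\<ge>m. v e i = 0) \<and>
        (\<forall>X\<subseteq>E. indep X \<longleftrightarrow>
           inj_on v X \<and> \<not> module.dependent (\<lambda>c x i. c * x i) (v ` X)))"

locale loopless_matroid = matroid +
  assumes loopless: "e \<in> E \<Longrightarrow> indep {e}"
begin

definition parallel :: "('a \<times> 'a) set" where
  "parallel = {(e, f). e \<in> E \<and> f \<in> E \<and> (e = f \<or> \<not> indep {e, f})}"

text \<open>The simplification keeps an arbitrarily chosen element of each parallel class.\<close>

definition si_ground :: "'a set" where
  "si_ground = (\<lambda>C. SOME e. e \<in> C) ` (E // parallel)"

definition si_indep :: "'a set \<Rightarrow> bool" where
  "si_indep X \<longleftrightarrow> X \<subseteq> si_ground \<and> indep X"

lemma equiv_parallel: "equiv E parallel"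
proof (rule equivI)
  show "parallel \<subseteq> E \<times> E" "refl_on E parallel"
    by (auto simp: parallel_def refl_on_def)
  show "sym parallel"
    by (auto simp: parallel_def sym_def insert_commute)
  show "trans parallel"
  proof (rule transI)
    fix e f g assume ef: "(e, f) \<in> parallel" and fg: "(f, g) \<in> parallel"
    show "(e, g) \<in> parallel"
    proof (cases "e = f \<or> f = g \<or> e = g")
      case True
      then show ?thesis using ef fg by (auto simp: parallel_def)
    next
      case False
      have "\<not> indep {e, g}"
      proof
        assume eg: "indep {e, g}"
        have "indep {f}" using ef loopless by (auto simp: parallel_def)
        with eg False obtain y where "y \<in> {e, g}" "indep {y, f}"
          using augment[of "{f}" "{e, g}"] by auto
        then show False using ef fg False by (auto simp: parallel_def insert_commute)
      qed
      then show ?thesis using ef fg by (auto simp: parallel_def)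
    qed
  qed
qed

lemma si_ground_subset: "si_ground \<subseteq> E"
proof
  fix e assume "e \<in> si_ground"
  then obtain C where C: "C \<in> E // parallel" "e = (SOME e. e \<in> C)"
    by (auto simp: si_ground_def)
  then have "e \<in> C"
    using in_quotient_imp_non_empty[OF equiv_parallel] by (simp add: some_in_eq)
  then show "e \<in> E" using in_quotient_imp_subset[OF equiv_parallel C(1)] by auto
qed

lemma si_matroid: "matroid si_ground si_indep"
proof
  show "finite si_ground" using si_ground_subset finite_ground finite_subset by blast
  show "\<exists>y\<in>Y - X. si_indep (insert y X)"
    if "si_indep X" "si_indep Y" "card X < card Y" for X Y
    using that augment[of X Y] by (auto simp: si_indep_def)
qed (auto simp: si_indep_def indep_empty intro: indep_subset)

definition si_covering_number :: nat where
  "si_covering_number = matroid.covering_number si_ground si_indep"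

end

end

theory Submission
  imports Defs "HOL-Library.FuncSet"
begin

text \<open>
  Write \<open>q = p ^ k\<close>.  By inclusion-exclusion, \<open>\<chi>\<^sub>M(q)\<close> is, up to a power of \<open>q\<close>, the number of linear
  functionals that vanish at no vector of the representation.  Extending the \<open>k\<close> independent sets
  that cover the simplification to bases \<open>B\<^sub>0, \<dots>, B\<^sub>k\<^sub>-\<^sub>1\<close>, such a functional exists if the sum over
  all \<open>x\<close> of \<open>\<Prod>i<k. (\<Prod>b\<in>B\<^sub>i. \<langle>b, x\<rangle> ^ (p - 1)) ^ (p ^ i)\<close> is nonzero.  If all \<open>B\<^sub>i\<close> are the standard
  basis, the product is \<open>\<Prod>t. x\<^sub>t ^ (q - 1)\<close> and the sum is \<open>\<plusminus>1\<close>.  Exchanging one vector of one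
  \<open>B\<^sub>i\<close> multiplies the sum by a nonzero scalar: the error terms contain a \<open>p\<close>-th power of a linear
  form, and after a Frobenius twist their degree is too small for a nonzero sum.
\<close>

section \<open>Sums of polynomial functions over a finite field\<close>

text \<open>Translation by \<open>1\<close> permutes the field, and it changes the sum of all
  elements by their number.\<close>

lemma of_nat_card_field: "of_nat CARD('f::finite_field) = (0 :: 'f)"
proof -
  have "(\<Sum>t\<in>(UNIV :: 'f set). t) = (\<Sum>t\<in>(UNIV :: 'f set). t + 1)"
    by (rule sum.reindex_bij_witness[of _ "\<lambda>t. t + 1" "\<lambda>t. t - 1"]) auto
  then show ?thesis by (simp add: sum.distrib)
qed

text \<open>Substituting \<open>g * t\<close> for \<open>t\<close> multiplies the sum by
  \<open>g ^ a\<close>. For \<open>a > 0\<close> some nonzero \<open>g\<close> has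
  \<open>g ^ a \<noteq> 1\<close>, since \<open>X ^ a - 1\<close> has at most \<open>a\<close>
  roots; for \<open>a = 0\<close> the convention \<open>0 ^ 0 = 1\<close> turns the sum into the
  cardinality of the field.\<close>

lemma sum_power_eq_0:
  fixes a :: nat
  assumes "a < CARD('f::finite_field) - 1"
  shows "(\<Sum>t\<in>(UNIV :: 'f set). t ^ a) = 0"
proof (cases "a = 0")
  case True
  then show ?thesis by (simp add: of_nat_card_field)
next
  case False
  define P :: "'f poly" where "P = monom 1 a - 1"
  have coeff: "coeff P a = 1" using False by (simp add: P_def)
  then have "P \<noteq> 0" by auto
  moreover have "degree P \<le> a"
    unfolding P_def by (intro degree_diff_le degree_monom_le) auto
  ultimately have card_roots: "card {t. poly P t = 0} \<le> a"
    using card_poly_roots_bound[of P] by simp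
  have "\<exists>g :: 'f. g \<noteq> 0 \<and> g ^ a \<noteq> 1"
  proof (rule ccontr)
    assume "\<not> ?thesis"
    then have "UNIV - {0} \<subseteq> {t. poly P t = 0}"
      by (auto simp: P_def poly_monom)
    then have "card (UNIV - {0 :: 'f}) \<le> a"
      using card_roots card_mono[of "{t. poly P t = 0}" "UNIV - {0}"] by simp
    then show False using assms by (simp add: card_Diff_singleton)
  qed
  then obtain g :: 'f where g: "g \<noteq> 0" "g ^ a \<noteq> 1" by blast
  have "(\<Sum>t\<in>UNIV. t ^ a) = (\<Sum>t\<in>UNIV. (g * t) ^ a)"
    by (rule sum.reindex_bij_witness[of _ "\<lambda>t. g * t" "\<lambda>t. t / g"]) (use g in auto)
  also have "\<dots> = g ^ a * (\<Sum>t\<in>UNIV. t ^ a)"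
    by (simp add: power_mult_distrib sum_distrib_left)
  finally show ?thesis using g by simp
qed

text \<open>Functions rather than formal polynomials: \<open>d\<close> bounds the degree of some
  polynomial in the first \<open>m\<close> coordinates that induces the function. Thus
  \<open>t ^ CARD('f) = t\<close> can lower a degree bound by mere rewriting.\<close>

inductive polyfun :: "nat \<Rightarrow> nat \<Rightarrow> ((nat \<Rightarrow> 'f::comm_ring_1) \<Rightarrow> 'f) \<Rightarrow> bool" for m where
  const: "polyfun m d (\<lambda>x. c)"
| coord_mult: "i < m \<Longrightarrow> polyfun m d f \<Longrightarrow> polyfun m (Suc d) (\<lambda>x. x i * f x)"
| add: "polyfun m d f \<Longrightarrow> polyfun m d g \<Longrightarrow> polyfun m d (\<lambda>x. f x + g x)"

lemma polyfun_mono: "polyfun m d f \<Longrightarrow> d \<le> e \<Longrightarrow> polyfun m e f"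
proof (induction arbitrary: e rule: polyfun.induct)
  case (coord_mult i d f)
  then obtain e' where "e = Suc e'" "d \<le> e'" by (cases e) auto
  then show ?case using coord_mult by (auto intro: polyfun.coord_mult)
qed (auto intro: polyfun.const polyfun.add)

lemma polyfun_cmult: "polyfun m d f \<Longrightarrow> polyfun m d (\<lambda>x. c * f x)"
proof (induction rule: polyfun.induct)
  case (coord_mult i d f)
  then have "polyfun m (Suc d) (\<lambda>x. x i * (c * f x))" by (intro polyfun.coord_mult)
  then show ?case by (simp add: mult_ac)
qed (auto intro: polyfun.const polyfun.add simp: distrib_left)

lemma polyfun_mult: "polyfun m d f \<Longrightarrow> polyfun m e g \<Longrightarrow> polyfun m (d + e) (\<lambda>x. f x * g x)"
proof (induction rule: polyfun.induct)
  case (const d c)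
  then show ?case by (auto intro: polyfun_cmult polyfun_mono)
next
  case (coord_mult i d f)
  then have "polyfun m (Suc (d + e)) (\<lambda>x. x i * (f x * g x))" by (intro polyfun.coord_mult) auto
  then show ?case by (simp add: mult_ac)
qed (auto intro: polyfun.add simp: distrib_right)

lemma polyfun_power: "polyfun m d f \<Longrightarrow> polyfun m (n * d) (\<lambda>x. f x ^ n)"
  by (induction n) (auto intro: polyfun.const polyfun_mult)

lemma polyfun_sum:
  "(\<And>i. i \<in> I \<Longrightarrow> polyfun m d (f i)) \<Longrightarrow> polyfun m d (\<lambda>x. \<Sum>i\<in>I. f i x)"
  by (induction I rule: infinite_finite_induct) (auto intro: polyfun.const polyfun.add)

lemma polyfun_prod:
  "(\<And>i. i \<in> I \<Longrightarrow> polyfun m (d i) (f i)) \<Longrightarrow> polyfun m (\<Sum>i\<in>I. d i) (\<lambda>x. \<Prod>i\<in>I. f i x)"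
  by (induction I rule: infinite_finite_induct) (auto intro: polyfun.const polyfun_mult)

text \<open>Points carry \<open>undefined\<close> beyond index \<open>m\<close>, so that sums over them factor by
  \<open>prod_sum_PiE\<close>; the vectors paired with them vanish there.\<close>

abbreviation points :: "nat \<Rightarrow> (nat \<Rightarrow> 'f) set" where
  "points m \<equiv> {..<m} \<rightarrow>\<^sub>E UNIV"

lemma sum_monomial:
  "(\<Sum>x\<in>(points m :: (nat \<Rightarrow> 'f::finite_field) set). \<Prod>i<m. x i ^ a i) = (\<Prod>i<m. \<Sum>t\<in>UNIV. t ^ a i)"
  by (rule prod_sum_PiE[symmetric]) auto

text \<open>The induction strips coordinates from \<open>f\<close> and collects them in the
  monomial, hence the general exponents \<open>a\<close>. At a constant, the degree bound leaves
  some exponent below \<open>CARD('f) - 1\<close>, and the power sum in that coordinate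
  vanishes.\<close>

lemma sum_monomial_mult_polyfun_eq_0:
  fixes f :: "(nat \<Rightarrow> 'f::finite_field) \<Rightarrow> 'f"
  assumes "polyfun m d f" and "(\<Sum>i<m. a i) + d < m * (CARD('f) - 1)"
  shows "(\<Sum>x\<in>points m. (\<Prod>i<m. x i ^ a i) * f x) = 0"
  using assms
proof (induction arbitrary: a rule: polyfun.induct)
  case (const d c)
  have "\<exists>i<m. a i < CARD('f) - 1"
  proof (rule ccontr)
    assume "\<not> ?thesis"
    then have "(\<Sum>i<m. CARD('f) - 1) \<le> (\<Sum>i<m. a i)" by (intro sum_mono) (meson lessThan_iff not_less)
    then show False using const by simp
  qed
  then have "(\<Prod>i<m. \<Sum>t\<in>(UNIV :: 'f set). t ^ a i) = 0"
    using sum_power_eq_0 by (auto intro: prod_zero)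
  then show ?case by (simp add: sum_distrib_right[symmetric] sum_monomial)
next
  case (coord_mult i d f)
  let ?a = "a(i := Suc (a i))"
  have "(\<Sum>i<m. ?a i) = Suc (\<Sum>i<m. a i)"
    using coord_mult(1) by (simp add: sum.remove[of "{..<m}" i])
  then have "(\<Sum>x\<in>points m. (\<Prod>i<m. x i ^ ?a i) * f x) = 0"
    using coord_mult by (intro coord_mult.IH) auto
  moreover have "(\<Prod>i<m. x i ^ ?a i) = (\<Prod>i<m. x i ^ a i) * x i" for x :: "nat \<Rightarrow> 'f"
    using coord_mult(1) by (simp add: prod.remove[of "{..<m}" i])
  ultimately show ?case by (simp add: mult_ac)
next
  case (add d f g)
  then show ?case by (simp add: distrib_left sum.distrib)
qed

text \<open>The vanishing statement behind the Chevalley-Warning theorem.\<close>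

lemma sum_polyfun_eq_0:
  fixes f :: "(nat \<Rightarrow> 'f::finite_field) \<Rightarrow> 'f"
  assumes "polyfun m d f" and "d < m * (CARD('f) - 1)"
  shows "(\<Sum>x\<in>points m. f x) = 0"
  using sum_monomial_mult_polyfun_eq_0[of m d f "\<lambda>_. 0"] assms by simp

section \<open>Linear forms and arithmetic of the field order\<close>

definition pairing :: "nat \<Rightarrow> (nat \<Rightarrow> 'f::comm_ring_1) \<Rightarrow> (nat \<Rightarrow> 'f) \<Rightarrow> 'f" where
  "pairing m w x = (\<Sum>i<m. w i * x i)"

lemma pairing_zero [simp]: "pairing m 0 x = 0"
  by (simp add: pairing_def)

lemma pairing_add: "pairing m (w + u) x = pairing m w x + pairing m u x"
  by (simp add: pairing_def distrib_right sum.distrib)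

lemma pairing_diff: "pairing m (w - u) x = pairing m w x - pairing m u x"
  by (simp add: pairing_def left_diff_distrib sum_subtractf)

lemma pairing_scale: "pairing m (\<lambda>i. c * w i) x = c * pairing m w x"
  by (simp add: pairing_def sum_distrib_left mult.assoc)

lemma polyfun_pairing: "polyfun m 1 (pairing m w)"
proof -
  have "polyfun m 1 (\<lambda>x. w i * x i)" if "i < m" for i
    using polyfun_cmult[OF polyfun.coord_mult[OF that polyfun.const[of m 0 1]]] by simp
  then show ?thesis unfolding pairing_def by (intro polyfun_sum) auto
qed

lemma char_eq_of_card:
  assumes "prime p" and "CARD('f::finite_field) = p ^ k"
  shows "CHAR('f) = p"
  using of_nat_card_field[where 'f = 'f] assms
  by (metis CHAR_prime of_nat_eq_0_iff_char_dvd prime_dvd_power primes_dvd_imp_eq)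

text \<open>All \<open>k\<close> digits of \<open>p ^ k - 1\<close> in base \<open>p\<close> are
  \<open>p - 1\<close>.\<close>

lemma sum_geometric_nat:
  assumes "(p::nat) \<ge> 1"
  shows "(\<Sum>i<k. (p - 1) * p ^ i) = p ^ k - 1"
  using assms by (induction k) (auto simp: algebra_simps diff_mult_distrib2)

section \<open>Frobenius-twisted products\<close>

text \<open>The power \<open>p ^ i\<close> is an iterate of Frobenius, so in characteristic
  \<open>p\<close> the sum is additive in each factor \<open>G i\<close> separately.\<close>

definition twisted_sum :: "nat \<Rightarrow> nat \<Rightarrow> nat \<Rightarrow> (nat \<Rightarrow> (nat \<Rightarrow> 'f) \<Rightarrow> 'f) \<Rightarrow> 'f::finite_field" where
  "twisted_sum p k m G = (\<Sum>x\<in>points m. \<Prod>i<k. G i x ^ (p ^ i))"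

lemma twisted_sum_upd:
  assumes "j < k"
  shows "twisted_sum p k m (G(j := f)) =
    (\<Sum>x\<in>points m. f x ^ (p ^ j) * (\<Prod>i\<in>{..<k} - {j}. G i x ^ (p ^ i)))"
  unfolding twisted_sum_def using assms
  by (intro sum.cong refl) (simp add: prod.remove[of "{..<k}" j])

lemma twisted_sum_cmult:
  "j < k \<Longrightarrow> twisted_sum p k m (G(j := \<lambda>x. c * f x)) = c ^ (p ^ j) * twisted_sum p k m (G(j := f))"
  by (simp add: twisted_sum_upd power_mult_distrib sum_distrib_left mult.assoc)

lemma twisted_sum_add:
  fixes f g :: "(nat \<Rightarrow> 'f::finite_field) \<Rightarrow> 'f"
  assumes "CHAR('f) = p" and "j < k"
  shows "twisted_sum p k m (G(j := \<lambda>x. f x + g x)) =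
    twisted_sum p k m (G(j := f)) + twisted_sum p k m (G(j := g))"
proof -
  have "(f x + g x) ^ (p ^ j) = f x ^ (p ^ j) + g x ^ (p ^ j)" for x
    using assms(1) by (intro freshmans_dream') auto
  then show ?thesis using assms(2) by (simp add: twisted_sum_upd distrib_right sum.distrib)
qed

text \<open>A twist by Frobenius moves the factor containing \<open>l ^ p\<close> to exponent \<open>p ^ (k - 1)\<close>,
  where \<open>l ^ (p ^ k) = l\<close> as functions, so that the degree drops below \<open>m * (p ^ k - 1)\<close>.\<close>

lemma twisted_sum_eq_0:
  fixes G :: "nat \<Rightarrow> (nat \<Rightarrow> 'f::finite_field) \<Rightarrow> 'f"
  assumes p: "prime p" and card: "CARD('f) = p ^ k" and j: "j < k"
    and G: "\<And>i. i < k \<Longrightarrow> i \<noteq> j \<Longrightarrow> polyfun m (m * (p - 1)) (G i)"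
    and H: "polyfun m h H" and h: "h + p = m * (p - 1)"
  shows "twisted_sum p k m (G(j := \<lambda>x. pairing m w x ^ p * H x)) = 0"
proof -
  define P where "P = (\<lambda>x. pairing m w x ^ p * H x)"
  \<comment> \<open>\<open>r\<close> is the number of Frobenius steps that take index
    \<open>j\<close> to \<open>k - 1\<close>; \<open>s\<close> is the resulting cyclic shift of all
    indices.\<close>
  define r where "r = k - 1 - j"
  define s where "s i = (i + r) mod k" for i
  have sj: "s j = k - 1" using j by (simp add: s_def r_def)
  have p1: "p \<ge> 2" using p prime_ge_2_nat by blast
  have s_lt: "s i < k" for i using j by (simp add: s_def)
  have shift: "((i + c) mod k + d) mod k = i" if "i < k" "c + d = k" for i c d
    using that by (simp add: mod_add_left_eq add.assoc)
  have s_bij: "bij_betw s {..<k} {..<k}"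
    using j s_lt shift[where c = r and d = "Suc j"] shift[where c = "Suc j" and d = r]
    by (intro bij_betw_byWitness[where f' = "\<lambda>i. (i + Suc j) mod k"])
      (auto simp: s_def r_def simp del: add_Suc_right)
  \<comment> \<open>Exponents of \<open>p\<close> matter only modulo \<open>k\<close>, because
    \<open>t ^ (p ^ k) = t\<close> in the field.\<close>
  have pow_s: "t ^ (p ^ (i + r)) = t ^ (p ^ s i)" for t :: 'f and i
  proof -
    have "p ^ (i + r) = CARD('f) ^ ((i + r) div k) * p ^ s i"
      unfolding s_def card power_mult[symmetric] power_add[symmetric] by simp
    then show ?thesis
      by (simp add: power_mult finite_field_power_card_power_eq_same)
  qed
  define F where "F x = pairing m w x * H x ^ (p ^ (k - 1)) *
    (\<Prod>i\<in>{..<k} - {j}. G i x ^ (p ^ s i))" for x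
  \<comment> \<open>The \<open>p\<close>-th power of the linear form becomes its
    \<open>p ^ k\<close>-th power, which is the form itself.\<close>
  have pP: "P x ^ (p ^ (k - 1)) = pairing m w x * H x ^ (p ^ (k - 1))" for x
  proof -
    have "p * p ^ (k - 1) = CARD('f)" using j card by (cases k) auto
    then show ?thesis
      by (simp add: P_def power_mult_distrib power_mult[symmetric] finite_field_power_card_eq_same)
  qed
  have twist: "(P x ^ (p ^ j) * (\<Prod>i\<in>{..<k} - {j}. G i x ^ (p ^ i))) ^ (p ^ r) = F x" for x
    by (simp add: prod_power_distrib power_mult_distrib power_mult[symmetric] power_add[symmetric]
        pow_s sj pP F_def del: One_nat_def)
  define d where "d = 1 + p ^ (k - 1) * h + (\<Sum>i\<in>{..<k} - {j}. p ^ s i * (m * (p - 1)))"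
  have "polyfun m d F"
    unfolding F_def[abs_def] d_def using G H
    by (intro polyfun_mult polyfun_prod polyfun_power polyfun_pairing) auto
  \<comment> \<open>Without this reduction the bound would be exactly
    \<open>m * (CARD('f) - 1)\<close>; a contribution \<open>p ^ (k - 1) * p\<close> to it has been
    replaced by \<open>1\<close>.\<close>
  moreover have "d < m * (CARD('f) - 1)"
  proof -
    have "(\<Sum>i<k. p ^ s i * (m * (p - 1))) = (\<Sum>i<k. p ^ i * (m * (p - 1)))"
      by (rule sum.reindex_bij_betw[OF s_bij])
    also have "\<dots> = m * (\<Sum>i<k. (p - 1) * p ^ i)"
      by (simp add: sum_distrib_left mult_ac)
    also have "\<dots> = m * (CARD('f) - 1)" using p1 sum_geometric_nat[of p k] by (simp add: card)
    finally have "m * (CARD('f) - 1) = p ^ (k - 1) * (m * (p - 1)) +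
        (\<Sum>i\<in>{..<k} - {j}. p ^ s i * (m * (p - 1)))"
      using j sj by (simp add: sum.remove[of "{..<k}" j])
    moreover have "p ^ (k - 1) * (m * (p - 1)) = p ^ (k - 1) * h + p ^ (k - 1) * p"
      by (simp only: h[symmetric] distrib_left)
    moreover have "1 < p ^ (k - 1) * p" using p1 mult_le_mono[of 1 "p ^ (k - 1)" 2 p] by simp
    ultimately show ?thesis by (simp add: d_def)
  qed
  ultimately have "(\<Sum>x\<in>points m. F x) = 0" by (rule sum_polyfun_eq_0)
  \<comment> \<open>Raising to the power \<open>p ^ r\<close> commutes with the sum, and only
    \<open>0\<close> is sent to \<open>0\<close>.\<close>
  then have "twisted_sum p k m (G(j := P)) ^ (p ^ r) = 0"
    using char_eq_of_card[OF p card] p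
    by (simp add: twisted_sum_upd[OF j] freshmans_dream_sum' twist)
  then show ?thesis by (simp add: P_def)
qed

text \<open>The scaling is the one in \<open>representable_over\<close>, so
  \<open>vec.independent\<close> is independence in the sense of the representation.\<close>

interpretation vec: vector_space "\<lambda>(c :: 'f::field) (w :: nat \<Rightarrow> 'f) i. c * w i"
  by unfold_locales (auto simp: fun_eq_iff algebra_simps)

text \<open>By linearity in \<open>u\<close> it suffices to treat \<open>u\<close> in
  \<open>A\<close>; there the extra form completes a factor of exponent \<open>p - 1\<close> to a
  \<open>p\<close>-th power, and \<open>twisted_sum_eq_0\<close> applies.\<close>

lemma twisted_sum_span_eq_0:
  fixes G :: "nat \<Rightarrow> (nat \<Rightarrow> 'f::finite_field) \<Rightarrow> 'f"
  assumes p: "prime p" and card: "CARD('f) = p ^ k" and j: "j < k"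
    and G: "\<And>i. i < k \<Longrightarrow> i \<noteq> j \<Longrightarrow> polyfun m (m * (p - 1)) (G i)"
    and A: "finite A" "card A + 1 = m" and Q: "polyfun m (p - 2) Q" and u: "u \<in> vec.span A"
  shows "twisted_sum p k m
    (G(j := \<lambda>x. pairing m u x * ((\<Prod>a\<in>A. pairing m a x ^ (p - 1)) * Q x))) = 0"
proof -
  define R where "R = (\<lambda>x. (\<Prod>a\<in>A. pairing m a x ^ (p - 1)) * Q x)"
  define Z where "Z u \<longleftrightarrow> twisted_sum p k m (G(j := \<lambda>x. pairing m u x * R x)) = 0" for u
  have "Z u"
  proof (rule vec.span_induct_alt[OF u])
    show "Z 0"
      using p by (simp add: Z_def twisted_sum_upd[OF j] zero_power prime_gt_0_nat)
  next
    fix c a y assume a: "a \<in> A" and y: "Z y"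
    define H where "H = (\<lambda>x. (\<Prod>b\<in>A - {a}. pairing m b x ^ (p - 1)) * Q x)"
    define h where "h = (\<Sum>b\<in>A - {a}. (p - 1) * 1) + (p - 2)"
    have p2: "p \<ge> 2" using p prime_ge_2_nat by blast
    have "polyfun m h H"
      unfolding H_def h_def by (intro polyfun_mult polyfun_prod polyfun_power polyfun_pairing Q)
    \<comment> \<open>After removing \<open>a\<close>, there remain \<open>m - 2\<close> forms of
      exponent \<open>p - 1\<close>, so \<open>h = (m - 2) * (p - 1) + (p - 2)\<close>.\<close>
    moreover have "h + p = m * (p - 1)"
    proof -
      obtain n where n: "card A = Suc n" using A a by (cases "card A") auto
      obtain s where s: "p = Suc (Suc s)" using p2 by (metis One_nat_def Suc_1 le_iff_add plus_nat.simps)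
      show ?thesis using A(2) a A(1) n s by (auto simp: h_def card_Diff_singleton algebra_simps)
    qed
    moreover have "pairing m a x * R x = pairing m a x ^ p * H x" for x
    proof -
      have "pairing m a x * pairing m a x ^ (p - 1) = pairing m a x ^ p"
        using p2 by (cases p) auto
      then show ?thesis
        using A a by (simp add: R_def H_def prod.remove[of A a] mult.assoc[symmetric])
    qed
    ultimately have "twisted_sum p k m (G(j := \<lambda>x. pairing m a x * R x)) = 0"
      using twisted_sum_eq_0[OF p card j G] by simp
    moreover have "twisted_sum p k m (G(j := \<lambda>x. pairing m y x * R x)) = 0"
      using y by (simp add: Z_def)
    moreover have "twisted_sum p k m (G(j := \<lambda>x. pairing m ((\<lambda>i. c * a i) + y) x * R x)) =
        twisted_sum p k m (G(j := \<lambda>x. c * (pairing m a x * R x) + pairing m y x * R x))"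
      by (simp add: pairing_add pairing_scale distrib_right mult.assoc)
    ultimately show "Z ((\<lambda>i. c * a i) + y)"
      using char_eq_of_card[OF p card] j by (simp add: Z_def twisted_sum_add twisted_sum_cmult)
  qed
  then show ?thesis by (simp add: Z_def R_def)
qed

text \<open>The difference of the \<open>(p - 1)\<close>-th powers of the forms of \<open>b\<close>
  and \<open>c * w\<close> is the form of \<open>b - c * w\<close> times a cofactor \<open>Q\<close>
  of degree \<open>p - 2\<close>. Since \<open>b - c * w\<close> lies in the span of
  \<open>A\<close>, this error term contributes nothing.\<close>

lemma twisted_sum_exchange:
  fixes G :: "nat \<Rightarrow> (nat \<Rightarrow> 'f::finite_field) \<Rightarrow> 'f"
  assumes p: "prime p" and card: "CARD('f) = p ^ k" and j: "j < k"
    and G: "\<And>i. i < k \<Longrightarrow> i \<noteq> j \<Longrightarrow> polyfun m (m * (p - 1)) (G i)"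
    and A: "finite A" "card A + 1 = m" and u: "b - (\<lambda>i. c * w i) \<in> vec.span A"
  shows "twisted_sum p k m
      (G(j := \<lambda>x. (\<Prod>a\<in>A. pairing m a x ^ (p - 1)) * pairing m b x ^ (p - 1))) =
    (c ^ (p - 1)) ^ (p ^ j) * twisted_sum p k m
      (G(j := \<lambda>x. (\<Prod>a\<in>A. pairing m a x ^ (p - 1)) * pairing m w x ^ (p - 1)))"
    (is "twisted_sum p k m (G(j := ?B)) = _ * twisted_sum p k m (G(j := ?W))")
proof -
  let ?u = "b - (\<lambda>i. c * w i)"
  define R where "R = (\<lambda>x. \<Prod>a\<in>A. pairing m a x ^ (p - 1))"
  define Q where "Q = (\<lambda>x. \<Sum>i<p - 1. (c * pairing m w x) ^ (p - 1 - Suc i) * pairing m b x ^ i)"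
  have p2: "p \<ge> 2" using p prime_ge_2_nat by blast
  have "polyfun m (p - 2) Q"
    unfolding Q_def
  proof (rule polyfun_sum)
    fix i assume "i \<in> {..<p - 1}"
    then have "(p - 1 - Suc i) * 1 + i * 1 = p - 2" by auto
    moreover have "polyfun m ((p - 1 - Suc i) * 1 + i * 1)
        (\<lambda>x. (c * pairing m w x) ^ (p - 1 - Suc i) * pairing m b x ^ i)"
      by (intro polyfun_mult polyfun_power polyfun_cmult polyfun_pairing)
    ultimately show "polyfun m (p - 2) (\<lambda>x. (c * pairing m w x) ^ (p - 1 - Suc i) * pairing m b x ^ i)"
      by simp
  qed
  from twisted_sum_span_eq_0[OF p card j G A this u]
  have "twisted_sum p k m (G(j := \<lambda>x. pairing m ?u x * (R x * Q x))) = 0"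
    by (simp add: R_def)
  moreover have "?B = (\<lambda>x. c ^ (p - 1) * ?W x + pairing m ?u x * (R x * Q x))"
  proof
    fix x
    have eq: "pairing m b x ^ (p - 1) = (c * pairing m w x) ^ (p - 1) + pairing m ?u x * Q x"
      using power_diff_sumr2[of "pairing m b x" "p - 1" "c * pairing m w x"]
      by (simp add: pairing_diff pairing_scale Q_def algebra_simps)
    show "?B x = c ^ (p - 1) * ?W x + pairing m ?u x * (R x * Q x)"
      unfolding eq by (simp add: R_def power_mult_distrib algebra_simps)
  qed
  ultimately show ?thesis
    using char_eq_of_card[OF p card] j by (simp add: twisted_sum_add twisted_sum_cmult)
qed

section \<open>Bases of the coordinate space\<close>

definition vecs :: "nat \<Rightarrow> (nat \<Rightarrow> 'f::zero) set" where
  "vecs m = {w. \<forall>i\<ge>m. w i = 0}"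

definition unit_vec :: "nat \<Rightarrow> nat \<Rightarrow> 'f::zero_neq_one" where
  "unit_vec i = (\<lambda>t. if t = i then 1 else 0)"

definition is_basis :: "nat \<Rightarrow> (nat \<Rightarrow> 'f::field) set \<Rightarrow> bool" where
  "is_basis m B \<longleftrightarrow> vec.independent B \<and> vec.span B = vecs m"

lemma inj_unit_vec: "inj unit_vec"
  by (auto simp: inj_def unit_vec_def fun_eq_iff split: if_splits)

lemma pairing_unit_vec: "i < m \<Longrightarrow> pairing m (unit_vec i) x = x i"
  by (simp add: pairing_def unit_vec_def if_distrib[of "\<lambda>t. t * _"] cong: if_cong)

lemma sum_fun_apply: "(\<Sum>i\<in>I. f i) x = (\<Sum>i\<in>I. f i x)"
  by (induction I rule: infinite_finite_induct) auto

lemma is_basis_unit_vec: "is_basis m (unit_vec ` {..<m} :: (nat \<Rightarrow> 'f::field) set)"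
proof -
  have comb: "(\<Sum>v\<in>unit_vec ` {..<m}. (\<lambda>i. f v * v i)) t = (if t < m then f (unit_vec t) else 0)"
    for f :: "(nat \<Rightarrow> 'f) \<Rightarrow> 'f" and t
  proof -
    have "(\<Sum>v\<in>unit_vec ` {..<m}. (\<lambda>i. f v * v i)) t = (\<Sum>i<m. f (unit_vec i) * unit_vec i t)"
      unfolding sum_fun_apply by (rule sum.reindex_cong[OF inj_on_subset[OF inj_unit_vec]]) auto
    also have "\<dots> = (\<Sum>i<m. if t = i then f (unit_vec i) else 0)"
      by (intro sum.cong) (auto simp: unit_vec_def)
    finally show ?thesis by simp
  qed
  have "vec.independent (unit_vec ` {..<m} :: (nat \<Rightarrow> 'f) set)"
  proof (rule vec.independent_if_scalars_zero)
    fix f :: "(nat \<Rightarrow> 'f) \<Rightarrow> 'f" and v :: "nat \<Rightarrow> 'f"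
    assume 0: "(\<Sum>v\<in>unit_vec ` {..<m}. (\<lambda>i. f v * v i)) = 0" and "v \<in> unit_vec ` {..<m}"
    then obtain t where "t < m" "v = unit_vec t" by auto
    then show "f v = 0" using comb[of f t] 0 by simp
  qed auto
  moreover have "vec.span (unit_vec ` {..<m} :: (nat \<Rightarrow> 'f) set) = vecs m"
  proof
    show "vec.span (unit_vec ` {..<m}) \<subseteq> (vecs m :: (nat \<Rightarrow> 'f) set)"
      by (auto simp: vec.span_finite vecs_def comb)
    show "(vecs m :: (nat \<Rightarrow> 'f) set) \<subseteq> vec.span (unit_vec ` {..<m})"
    proof
      fix w :: "nat \<Rightarrow> 'f" assume w: "w \<in> vecs m"
      \<comment> \<open>Coefficients are indexed by vectors, so \<open>inv unit_vec\<close> recovers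
        the index of the coordinate.\<close>
      have "w = (\<Sum>v\<in>unit_vec ` {..<m}. (\<lambda>i. w (inv unit_vec v) * v i))"
        using w by (auto simp: fun_eq_iff comb inv_f_f[OF inj_unit_vec] vecs_def)
      then show "w \<in> vec.span (unit_vec ` {..<m})"
        by (auto simp: vec.span_finite)
    qed
  qed
  ultimately show ?thesis by (simp add: is_basis_def)
qed

text \<open>The ambient function space is infinite-dimensional, so the size comes from comparison
  with the unit vectors, by the Steinitz bound in both directions.\<close>

lemma is_basis_finite_card:
  fixes B :: "(nat \<Rightarrow> 'f::field) set"
  assumes "is_basis m B"
  shows "finite B" and "card B = m"
proof -
  define U where "U = (unit_vec ` {..<m} :: (nat \<Rightarrow> 'f) set)"
  have U: "finite U" "card U = m" "vec.independent U" "vec.span U = vecs m"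
    using is_basis_unit_vec[of m, where 'f = 'f]
    by (auto simp: U_def is_basis_def card_image inj_on_subset[OF inj_unit_vec])
  have B: "vec.independent B" "vec.span B = vecs m" using assms by (auto simp: is_basis_def)
  have 1: "finite B \<and> card B \<le> card U"
    using vec.independent_span_bound[of U B] U B vec.span_superset[of B] by simp
  moreover have "card U \<le> card B"
    using vec.independent_span_bound[of B U] 1 U B vec.span_superset[of U] by simp
  ultimately show "finite B" "card B = m" using U by auto
qed

lemma is_basis_extend:
  assumes "vec.independent S" and "S \<subseteq> vecs m"
  obtains B where "S \<subseteq> B" "is_basis m B"
proof -
  obtain B where B: "S \<subseteq> B" "B \<subseteq> vecs m" "vec.independent B" "vecs m \<subseteq> vec.span B"
    using vec.maximal_independent_subset_extend[OF assms(2,1)] .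
  have "vec.span B \<subseteq> vecs m"
    using vec.span_mono[OF B(2)] vec.span_span is_basis_unit_vec[of m, where 'f = 'a]
    unfolding is_basis_def by metis
  then show ?thesis using that B by (auto simp: is_basis_def)
qed

text \<open>\<open>C\<close> spans the space and \<open>B - {w}\<close> does not, so some
  \<open>b\<close> in \<open>C\<close> lies outside the span of \<open>B - {w}\<close>. The scalar
  \<open>c\<close> is the coefficient of \<open>w\<close> in the expansion of \<open>b\<close> in
  \<open>B\<close>.\<close>

lemma is_basis_exchange:
  fixes B C :: "(nat \<Rightarrow> 'f::field) set"
  assumes B: "is_basis m B" and C: "is_basis m C" and w: "w \<in> B"
  obtains b c where "b \<in> C" "b \<notin> B - {w}" "is_basis m (insert b (B - {w}))"
    "b - (\<lambda>i. c * w i) \<in> vec.span (B - {w})"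
proof -
  have "\<not> C \<subseteq> vec.span (B - {w})"
  proof
    assume "C \<subseteq> vec.span (B - {w})"
    then have "vec.span C \<subseteq> vec.span (B - {w})" by (metis vec.span_mono vec.span_span)
    then have "w \<in> vec.span (B - {w})"
      using B C w vec.span_base[of w B] by (auto simp: is_basis_def)
    then show False using B w by (auto simp: is_basis_def vec.dependent_def)
  qed
  then obtain b where b: "b \<in> C" "b \<notin> vec.span (B - {w})" by blast
  have bB: "b \<in> vec.span B"
    using b B C vec.span_base[of b C] by (auto simp: is_basis_def)
  have "vec.independent (insert b (B - {w}))"
    using b B vec.independent_mono[of B "B - {w}"]
    by (intro vec.independent_insertI) (auto simp: is_basis_def)
  moreover have "vec.span (insert b (B - {w})) = vec.span B"
  proof
    have "insert b (B - {w}) \<subseteq> vec.span B" using bB vec.span_superset[of B] by auto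
    then show "vec.span (insert b (B - {w})) \<subseteq> vec.span B" by (metis vec.span_mono vec.span_span)
    have "w \<in> vec.span (insert b (B - {w}))" using vec.in_span_delete[OF bB b(2)] .
    then have "B \<subseteq> vec.span (insert b (B - {w}))"
      using vec.span_superset[of "insert b (B - {w})"] by auto
    then show "vec.span B \<subseteq> vec.span (insert b (B - {w}))" by (metis vec.span_mono vec.span_span)
  qed
  ultimately have "is_basis m (insert b (B - {w}))" using B by (simp add: is_basis_def)
  moreover obtain c where "b - (\<lambda>i. c * w i) \<in> vec.span (B - {w})"
    using vec.span_breakdown[OF w bB] by blast
  moreover have "b \<notin> B - {w}" using b(2) vec.span_base[of b "B - {w}"] by auto
  ultimately show ?thesis using that b by blast
qed

section \<open>Nonvanishing of the twisted sum and a common nonzero point\<close>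

text \<open>Induction on the number of vectors in all \<open>B i\<close> that are not unit vectors.
  After one exchange the new sum is a scalar multiple of the old one, so the old sum is nonzero
  because the new one is.\<close>

lemma twisted_sum_bases_neq_0:
  fixes B :: "nat \<Rightarrow> (nat \<Rightarrow> 'f::finite_field) set"
  assumes p: "prime p" and card: "CARD('f) = p ^ k"
    and B: "\<And>i. i < k \<Longrightarrow> is_basis m (B i)"
  shows "twisted_sum p k m (\<lambda>i x. \<Prod>b\<in>B i. pairing m b x ^ (p - 1)) \<noteq> 0"
  using B
proof (induction "\<Sum>i<k. card (B i - unit_vec ` {..<m})" arbitrary: B rule: less_induct)
  case less
  define U where "U = (unit_vec ` {..<m} :: (nat \<Rightarrow> 'f) set)"
  have U: "is_basis m U" unfolding U_def by (rule is_basis_unit_vec)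
  have p2: "p \<ge> 2" using p prime_ge_2_nat by blast
  show ?case
  proof (cases "\<forall>i<k. B i \<subseteq> U")
    case True
    have "B i = U" if "i < k" for i
      using that True less.prems U is_basis_finite_card by (metis card_subset_eq)
    then have "twisted_sum p k m (\<lambda>i x. \<Prod>b\<in>B i. pairing m b x ^ (p - 1)) =
        (\<Sum>x\<in>points m. \<Prod>i<k. (\<Prod>t<m. x t ^ (p - 1)) ^ (p ^ i) :: 'f)"
      unfolding twisted_sum_def U_def
      by (intro sum.cong prod.cong arg_cong2[where f = power] refl)
        (simp add: prod.reindex[OF inj_on_subset[OF inj_unit_vec]] pairing_unit_vec)
    \<comment> \<open>The exponents \<open>(p - 1) * p ^ i\<close> add up to
      \<open>CARD('f) - 1\<close>; the sum over points then factors over the coordinates.\<close>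
    also have "\<dots> = (\<Sum>x\<in>points m. \<Prod>t<m. x t ^ (CARD('f) - 1))"
    proof (intro sum.cong refl)
      fix x :: "nat \<Rightarrow> 'f"
      have "(\<Prod>i<k. (\<Prod>t<m. x t ^ (p - 1)) ^ (p ^ i)) = (\<Prod>t<m. x t) ^ (\<Sum>i<k. (p - 1) * p ^ i)"
        by (simp add: prod_power_distrib[symmetric] power_mult[symmetric] power_sum)
      then show "(\<Prod>i<k. (\<Prod>t<m. x t ^ (p - 1)) ^ (p ^ i)) = (\<Prod>t<m. x t ^ (CARD('f) - 1))"
        using p2 sum_geometric_nat[of p k] by (simp add: card prod_power_distrib)
    qed
    also have "\<dots> = (\<Sum>t\<in>(UNIV :: 'f set). t ^ (CARD('f) - 1)) ^ m"
      by (simp add: sum_monomial)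
    \<comment> \<open>The power \<open>t ^ (CARD('f) - 1)\<close> is the indicator of
      \<open>t \<noteq> 0\<close>, so the sum is \<open>CARD('f) - 1\<close>, which is
      \<open>- 1\<close> in the field.\<close>
    also have "(\<Sum>t\<in>(UNIV :: 'f set). t ^ (CARD('f) - 1)) = (\<Sum>t\<in>UNIV - {0 :: 'f}. 1)"
    proof -
      have 1: "CARD('f) > 1" using card_mono[of UNIV "{0, 1 :: 'f}"] by simp
      have "t ^ (CARD('f) - 1) = 1" if "t \<noteq> 0" for t :: 'f
      proof -
        have "t * t ^ (CARD('f) - 1) = t"
          using finite_field_power_card_eq_same[of t] 1 by (simp flip: power_Suc)
        then show ?thesis using that by simp
      qed
      then show ?thesis using 1 by (simp add: sum.remove[of UNIV "0 :: 'f"])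
    qed
    also have "\<dots> = - 1"
      using of_nat_card_field[where 'f = 'f] by (simp add: card_Diff_singleton of_nat_diff)
    finally show ?thesis by simp
  next
    case False
    then obtain j w where j: "j < k" and w: "w \<in> B j" "w \<notin> U" by blast
    obtain b c where b: "b \<in> U" "b \<notin> B j - {w}" "is_basis m (insert b (B j - {w}))"
      "b - (\<lambda>i. c * w i) \<in> vec.span (B j - {w})"
      using is_basis_exchange[OF less.prems[OF j] U w(1)] .
    define A where "A = B j - {w}"
    define B' where "B' = B(j := insert b A)"
    have fin: "finite (B j)" "card (B j) = m"
      using is_basis_finite_card[OF less.prems[OF j]] by auto
    then have A: "finite A" "card A + 1 = m"
      using w card_Suc_Diff1[of "B j" w] by (auto simp: A_def)
    define G where "G = (\<lambda>i x. \<Prod>b\<in>B i. pairing m b x ^ (p - 1))"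
    have G: "polyfun m (m * (p - 1)) (G i)" if "i < k" for i
    proof -
      have "polyfun m (\<Sum>b\<in>B i. (p - 1) * 1) (G i)"
        unfolding G_def by (intro polyfun_prod polyfun_power polyfun_pairing)
      then show ?thesis using is_basis_finite_card[OF less.prems[OF that]] by simp
    qed
    \<comment> \<open>\<open>w\<close> leaves and \<open>b\<close> is a unit vector, so the
      induction measure drops.\<close>
    have "insert b A - U = (B j - U) - {w}" using b by (auto simp: A_def)
    then have "card (insert b A - U) < card (B j - U)"
      using fin w by (metis Diff_iff card_Diff1_less finite_Diff)
    then have "(\<Sum>i<k. card (B' i - U)) < (\<Sum>i<k. card (B i - U))"
      using j by (intro sum_strict_mono_ex1) (auto simp: B'_def)
    moreover have "is_basis m (B' i)" if "i < k" for i
      using that b less.prems by (auto simp: B'_def A_def)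
    ultimately have "twisted_sum p k m (\<lambda>i x. \<Prod>b\<in>B' i. pairing m b x ^ (p - 1)) \<noteq> 0"
      unfolding U_def by (rule less.hyps)
    also have "(\<lambda>i x. \<Prod>b\<in>B' i. pairing m b x ^ (p - 1)) =
        G(j := \<lambda>x. (\<Prod>a\<in>A. pairing m a x ^ (p - 1)) * pairing m b x ^ (p - 1))"
      using A b by (auto simp: B'_def G_def A_def fun_eq_iff mult.commute)
    also have "twisted_sum p k m \<dots> = (c ^ (p - 1)) ^ (p ^ j) * twisted_sum p k m
        (G(j := \<lambda>x. (\<Prod>a\<in>A. pairing m a x ^ (p - 1)) * pairing m w x ^ (p - 1)))"
      by (rule twisted_sum_exchange[OF p card j G A]) (use b in \<open>auto simp: A_def\<close>)
    also have "G(j := \<lambda>x. (\<Prod>a\<in>A. pairing m a x ^ (p - 1)) * pairing m w x ^ (p - 1)) = G"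
      using w fin by (auto simp: fun_eq_iff G_def A_def prod.remove[of "B j" w])
    finally show ?thesis by (auto simp: G_def)
  qed
qed

text \<open>A nonzero sum has a nonzero term, and at the point of that term no form from the bases
  extending the \<open>S i\<close> vanishes.\<close>

lemma ex_pairing_neq_0:
  fixes S :: "nat \<Rightarrow> (nat \<Rightarrow> 'f::finite_field) set"
  assumes p: "prime p" and card: "CARD('f) = p ^ k"
    and S: "\<And>i. i < k \<Longrightarrow> vec.independent (S i) \<and> S i \<subseteq> vecs m"
  shows "\<exists>x\<in>points m. \<forall>i<k. \<forall>w\<in>S i. pairing m w x \<noteq> 0"
proof -
  have "\<exists>B. S i \<subseteq> B \<and> is_basis m B" if "i < k" for i
    using is_basis_extend S[OF that] by metis
  then obtain B where B: "\<And>i. i < k \<Longrightarrow> S i \<subseteq> B i \<and> is_basis m (B i)" by metis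
  have "twisted_sum p k m (\<lambda>i x. \<Prod>b\<in>B i. pairing m b x ^ (p - 1)) \<noteq> 0"
    using B by (intro twisted_sum_bases_neq_0[OF p card]) auto
  then obtain x where x: "x \<in> points m" "(\<Prod>i<k. (\<Prod>b\<in>B i. pairing m b x ^ (p - 1)) ^ (p ^ i)) \<noteq> 0"
    unfolding twisted_sum_def by (meson sum.not_neutral_contains_not_neutral)
  have "pairing m w x \<noteq> 0" if "i < k" "w \<in> S i" for i w
  proof
    assume "pairing m w x = 0"
    moreover have "w \<in> B i" "finite (B i)" "p - 1 > 0"
      using B[OF that(1)] that(2) is_basis_finite_card prime_gt_1_nat[OF p] by auto
    ultimately have "(\<Prod>b\<in>B i. pairing m b x ^ (p - 1)) = 0"
      by (auto intro!: prod_zero bexI[of _ w])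
    then have "(\<Prod>i<k. (\<Prod>b\<in>B i. pairing m b x ^ (p - 1)) ^ (p ^ i)) = 0"
      using that(1) prime_gt_0_nat[OF p] by (intro prod_zero) auto
    then show False using x by simp
  qed
  then show ?thesis using x(1) by blast
qed

section \<open>Counting common zeros of linear forms, and inclusion-exclusion\<close>

lemma pairing_span_eq_0:
  assumes "w \<in> vec.span S" and "\<And>s. s \<in> S \<Longrightarrow> pairing m s x = 0"
  shows "pairing m w x = 0"
proof (rule vec.span_induct_alt[where h = "\<lambda>w. pairing m w x = 0", OF assms(1)])
  show "pairing m ((\<lambda>i. c * s i) + u) x = 0" if "s \<in> S" "pairing m u x = 0" for c s u
    using assms(2) that by (simp add: pairing_add pairing_scale)
qed (rule pairing_zero)

text \<open>Evaluation at a basis containing \<open>S\<close> is a bijection from the points onto all value vectors.\<close>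

lemma card_annihilator:
  fixes S :: "(nat \<Rightarrow> 'f::finite_field) set"
  assumes "vec.independent S" and "S \<subseteq> vecs m"
  shows "card S \<le> m"
    and "card {x \<in> points m. \<forall>w\<in>S. pairing m w x = 0} = CARD('f) ^ (m - card S)"
proof -
  obtain B where B: "S \<subseteq> B" "is_basis m B" using is_basis_extend[OF assms] .
  have fin: "finite B" "card B = m" using is_basis_finite_card[OF B(2)] by auto
  have finS: "finite S" using B(1) fin finite_subset by blast
  show le: "card S \<le> m" using card_mono[OF fin(1) B(1)] fin(2) by simp
  define ev where "ev x = (\<lambda>w\<in>B. pairing m w x)" for x :: "nat \<Rightarrow> 'f"
  have inj: "inj_on ev (points m)"
  proof (rule inj_onI)
    fix x y :: "nat \<Rightarrow> 'f" assume xy: "x \<in> points m" "y \<in> points m" "ev x = ev y"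
    have eq0: "pairing m w (\<lambda>i. x i - y i) = pairing m w x - pairing m w y" for w
      by (simp add: pairing_def right_diff_distrib sum_subtractf)
    have "pairing m w (\<lambda>i. x i - y i) = 0" if "w \<in> B" for w
      using fun_cong[OF xy(3), of w] that by (simp add: ev_def eq0)
    then have *: "pairing m w (\<lambda>i. x i - y i) = 0" if "w \<in> vecs m" for w
      using pairing_span_eq_0[of w B] that B(2) by (auto simp: is_basis_def)
    have "x i = y i" if "i < m" for i
      using *[of "unit_vec i"] that pairing_unit_vec[OF that, of "\<lambda>i. x i - y i"]
      by (auto simp: vecs_def unit_vec_def)
    then show "x = y" using xy by (intro PiE_ext[of x "{..<m}" _ y]) auto
  qed
  \<comment> \<open>Both sets have \<open>CARD('f) ^ m\<close> elements, so injectivity gives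
    surjectivity.\<close>
  have "ev ` points m = B \<rightarrow>\<^sub>E UNIV"
  proof (rule card_subset_eq)
    show "finite (B \<rightarrow>\<^sub>E (UNIV :: 'f set))" using fin by (intro finite_PiE) auto
    show "ev ` points m \<subseteq> B \<rightarrow>\<^sub>E UNIV"
      by (intro image_subsetI) (simp add: ev_def)
    show "card (ev ` points m) = card (B \<rightarrow>\<^sub>E (UNIV :: 'f set))"
      using fin by (simp add: card_image[OF inj] card_PiE)
  qed
  then have bij: "bij_betw ev (points m) (B \<rightarrow>\<^sub>E UNIV)" using inj by (simp add: bij_betw_def)
  \<comment> \<open>Vanishing on \<open>S\<close> prescribes the value \<open>0\<close> there and
    leaves the values on \<open>B - S\<close> free.\<close>
  define T :: "(nat \<Rightarrow> 'f) \<Rightarrow> 'f set" where "T w = (if w \<in> S then {0} else UNIV)" for w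
  have "bij_betw ev {x \<in> points m. \<forall>w\<in>S. pairing m w x = 0} (PiE B T)"
  proof (rule bij_betw_imageI)
    show "inj_on ev {x \<in> points m. \<forall>w\<in>S. pairing m w x = 0}"
      using inj by (rule inj_on_subset) auto
    show "ev ` {x \<in> points m. \<forall>w\<in>S. pairing m w x = 0} = PiE B T"
    proof
      show "ev ` {x \<in> points m. \<forall>w\<in>S. pairing m w x = 0} \<subseteq> PiE B T"
        by (intro image_subsetI) (simp add: ev_def T_def)
      show "PiE B T \<subseteq> ev ` {x \<in> points m. \<forall>w\<in>S. pairing m w x = 0}"
      proof
        fix g assume g: "g \<in> PiE B T"
        then have "g \<in> ev ` points m" using bij by (auto simp: bij_betw_def PiE_def)
        then obtain x where x: "x \<in> points m" "g = ev x" by blast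
        have "pairing m w x = 0" if "w \<in> S" for w
          using PiE_mem[OF g, of w] that B(1) by (auto simp: x ev_def T_def split: if_splits)
        then show "g \<in> ev ` {x \<in> points m. \<forall>w\<in>S. pairing m w x = 0}" using x by auto
      qed
    qed
  qed
  then have "card {x \<in> points m. \<forall>w\<in>S. pairing m w x = 0} = (\<Prod>w\<in>B. card (T w))"
    using fin by (simp add: bij_betw_same_card card_PiE)
  also have "\<dots> = (\<Prod>w\<in>B - S. CARD('f))"
    using fin B(1) by (intro prod.mono_neutral_cong_right) (auto simp: T_def)
  also have "\<dots> = CARD('f) ^ (m - card S)"
    using B(1) finS fin by (simp add: card_Diff_subset)
  finally show "card {x \<in> points m. \<forall>w\<in>S. pairing m w x = 0} = CARD('f) ^ (m - card S)" .
qed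

text \<open>Inclusion-exclusion, as the expansion of the product over \<open>E\<close> of
  \<open>1\<close> minus the indicator of \<open>P e\<close>.\<close>

lemma prod_indicator_not:
  assumes "finite E"
  shows "(\<Sum>A\<in>Pow E. (- 1) ^ card A * (if \<forall>e\<in>A. P e then 1 else 0)) =
    (if \<forall>e\<in>E. \<not> P e then 1 else 0 :: int)"
proof -
  have "(\<Prod>e\<in>E. (if P e then - 1 else 0) + 1) =
      (\<Sum>A\<in>Pow E. (\<Prod>e\<in>A. if P e then - 1 else 0) * (\<Prod>e\<in>E - A. 1) :: int)"
    by (rule prod_add[OF assms])
  moreover have "(\<Prod>e\<in>A. if P e then - 1 else 0) = (- 1) ^ card A * (if \<forall>e\<in>A. P e then 1 else 0 :: int)"
    if "A \<in> Pow E" for A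
    using finite_subset[of A E] that assms by (auto intro: prod_zero)
  moreover have "(\<Prod>e\<in>E. (if P e then - 1 else 0) + 1) = (if \<forall>e\<in>E. \<not> P e then 1 else 0 :: int)"
    using assms by (auto intro: prod_zero)
  ultimately show ?thesis by simp
qed

section \<open>Characteristic polynomials of represented matroids\<close>

context matroid
begin

lemma finite_rank_candidates:
  "A \<subseteq> E \<Longrightarrow> finite (card ` {X. X \<subseteq> A \<and> indep X})"
  by (rule finite_imageI, rule finite_subset[of _ "Pow E"]) (use finite_ground in auto)

lemma card_le_rk: "A \<subseteq> E \<Longrightarrow> X \<subseteq> A \<Longrightarrow> indep X \<Longrightarrow> card X \<le> rk A"
  unfolding rk_def by (rule Max_ge[OF finite_rank_candidates]) auto

lemma obtain_rk:
  assumes "A \<subseteq> E"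
  obtains X where "X \<subseteq> A" "indep X" "card X = rk A"
proof -
  have "rk A \<in> card ` {X. X \<subseteq> A \<and> indep X}"
    unfolding rk_def using finite_rank_candidates[OF assms] indep_empty by (intro Max_in) auto
  then show ?thesis using that by auto
qed

lemma rk_mono:
  assumes "A \<subseteq> E"
  shows "rk A \<le> rk E"
proof -
  obtain X where "X \<subseteq> A" "indep X" "card X = rk A" using obtain_rk[OF assms] .
  then show ?thesis using card_le_rk[of E X] assms by auto
qed

text \<open>The count in the critical problem of Crapo and Rota: the points annihilated by all
  vectors of \<open>A\<close> number \<open>q ^ (m - rk A)\<close>. The factor
  \<open>q ^ (m - rk E)\<close> accounts for vectors that do not span the whole coordinate
  space.\<close>

lemma representation_char_poly:
  fixes v :: "'a \<Rightarrow> nat \<Rightarrow> 'f::finite_field"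
  assumes v: "\<And>e. e \<in> E \<Longrightarrow> v e \<in> vecs m"
    and indep_iff: "\<And>X. X \<subseteq> E \<Longrightarrow> indep X \<longleftrightarrow> inj_on v X \<and> vec.independent (v ` X)"
  shows "int (card {x \<in> points m. \<forall>e\<in>E. pairing m (v e) x \<noteq> 0}) =
    int CARD('f) ^ (m - rk E) * poly char_poly (int CARD('f))"
proof -
  define q where "q = int CARD('f)"
  have fin: "finite (points m :: (nat \<Rightarrow> 'f) set)" by (intro finite_PiE) auto
  have rk_le: "rk A \<le> m" and card_ann:
    "int (card {x \<in> points m. \<forall>e\<in>A. pairing m (v e) x = 0}) = q ^ (m - rk A)" if A: "A \<subseteq> E" for A
  proof -
    obtain X where X: "X \<subseteq> A" "indep X" "card X = rk A" using obtain_rk[OF A] .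
    have XE: "X \<subseteq> E" using X A by auto
    then have vX: "inj_on v X" "vec.independent (v ` X)" using indep_iff X by auto
    have card_vX: "card (v ` X) = rk A" using vX X by (simp add: card_image)
    have vX_vecs: "v ` X \<subseteq> vecs m" using v XE by auto
    \<comment> \<open>\<open>X\<close> is a largest independent subset of \<open>A\<close>, so no
      element of \<open>A\<close> with vector outside its span can be added.\<close>
    have span: "v e \<in> vec.span (v ` X)" if e: "e \<in> A" for e
    proof (rule ccontr)
      assume ns: "v e \<notin> vec.span (v ` X)"
      then have "v e \<notin> v ` X" using vec.span_base by blast
      then have "e \<notin> X" by auto
      have "insert e X \<subseteq> E" using A e XE by auto
      moreover have "inj_on v (insert e X)" using vX \<open>v e \<notin> v ` X\<close> by auto
      moreover have "vec.independent (v ` insert e X)"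
        using vec.independent_insertI[OF ns vX(2)] by simp
      ultimately have "indep (insert e X)" using indep_iff by blast
      then have "card (insert e X) \<le> rk A" using card_le_rk A X(1) e by auto
      then show False
        using \<open>e \<notin> X\<close> X(3) finite_subset[OF XE finite_ground] by simp
    qed
    have "(\<forall>e\<in>A. pairing m (v e) x = 0) \<longleftrightarrow> (\<forall>w\<in>v ` X. pairing m w x = 0)" for x
      using X(1) pairing_span_eq_0[OF span] by blast
    then show "int (card {x \<in> points m. \<forall>e\<in>A. pairing m (v e) x = 0}) = q ^ (m - rk A)"
      using card_annihilator(2)[OF vX(2) vX_vecs] by (simp add: card_vX q_def)
    show "rk A \<le> m" using card_annihilator(1)[OF vX(2) vX_vecs] by (simp add: card_vX)
  qed
  have "int (card {x \<in> points m. \<forall>e\<in>E. pairing m (v e) x \<noteq> 0}) =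
      (\<Sum>x\<in>points m. if \<forall>e\<in>E. pairing m (v e) x \<noteq> 0 then 1 else 0)"
    using fin by (simp add: sum.If_cases Int_def)
  also have "\<dots> = (\<Sum>x\<in>points m. \<Sum>A\<in>Pow E.
      (- 1) ^ card A * (if \<forall>e\<in>A. pairing m (v e) x = 0 then 1 else 0))"
    by (intro sum.cong refl) (rule prod_indicator_not[OF finite_ground, symmetric])
  also have "\<dots> = (\<Sum>A\<in>Pow E. (- 1) ^ card A *
      (\<Sum>x\<in>points m. if \<forall>e\<in>A. pairing m (v e) x = 0 then 1 else 0))"
    by (subst sum.swap) (simp add: sum_distrib_left)
  also have "\<dots> = (\<Sum>A\<in>Pow E. (- 1) ^ card A * q ^ (m - rk A))"
    using fin card_ann by (intro sum.cong refl) (simp add: sum.If_cases Int_def)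
  also have "\<dots> = (\<Sum>A\<in>Pow E. q ^ (m - rk E) * ((- 1) ^ card A * q ^ (rk E - rk A)))"
  proof (intro sum.cong refl)
    fix A assume "A \<in> Pow E"
    \<comment> \<open>The subtractions are exact because
      \<open>rk A \<le> rk E \<le> m\<close>.\<close>
    then have "m - rk A = (m - rk E) + (rk E - rk A)" using rk_mono[of A] rk_le[of E] by auto
    then show "(- 1) ^ card A * q ^ (m - rk A) = q ^ (m - rk E) * ((- 1) ^ card A * q ^ (rk E - rk A))"
      by (simp add: power_add)
  qed
  also have "\<dots> = q ^ (m - rk E) * poly char_poly q"
    by (simp add: char_poly_def poly_sum poly_monom sum_distrib_left)
  finally show ?thesis by (simp add: q_def)
qed

text \<open>The singletons form a cover, so the \<open>LEAST\<close> in
  \<open>covering_number\<close> is attained.\<close>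

lemma ex_covering:
  assumes "\<And>e. e \<in> E \<Longrightarrow> indep {e}"
  shows "\<exists>I :: nat \<Rightarrow> 'a set.
    (\<forall>i<covering_number. indep (I i)) \<and> E \<subseteq> (\<Union>i<covering_number. I i)"
proof -
  obtain f where "bij_betw f {0..<card E} E"
    using ex_bij_betw_nat_finite[OF finite_ground] by blast
  then have f: "f ` {..<card E} = E" by (simp add: bij_betw_def atLeast0LessThan)
  have "\<exists>I :: nat \<Rightarrow> 'a set. (\<forall>i<card E. indep (I i)) \<and> E \<subseteq> (\<Union>i<card E. I i)"
    using f assms by (intro exI[of _ "\<lambda>i. {f i}"]) blast
  then show ?thesis unfolding covering_number_def by (rule LeastI)
qed

end

section \<open>From the simplification to the whole matroid\<close>

context loopless_matroid
begin

lemma ex_parallel_si_ground: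
  assumes "e \<in> E"
  obtains s where "s \<in> si_ground" "(e, s) \<in> parallel"
proof -
  let ?C = "parallel `` {e}"
  have C: "?C \<in> E // parallel" using assms by (rule quotientI)
  have "e \<in> ?C" using equiv_parallel assms by (rule equiv_class_self)
  then have "(e, SOME s. s \<in> ?C) \<in> parallel" using someI[of "\<lambda>s. s \<in> ?C" e] by blast
  moreover have "(SOME s. s \<in> ?C) \<in> si_ground" using C unfolding si_ground_def by (rule imageI)
  ultimately show ?thesis using that by blast
qed

end

theorem theorem4p3:
  fixes p k :: nat and E :: "'a set" and indep :: "'a set \<Rightarrow> bool"
  assumes "prime p" and "k \<ge> 1"
    and "CARD('f::finite_field) = p ^ k"
    and "loopless_matroid E indep"
    and "representable_over TYPE('f) E indep"
    and "loopless_matroid.si_covering_number E indep \<le> k"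
  shows "poly (matroid.char_poly E indep) (int (p ^ k)) > 0"
proof -
  interpret loopless_matroid E indep by fact
  interpret si: matroid si_ground si_indep by (rule si_matroid)
  obtain m and v :: "'a \<Rightarrow> nat \<Rightarrow> 'f"
    where v: "\<And>e. e \<in> E \<Longrightarrow> v e \<in> vecs m"
      and indep_iff: "\<And>X. X \<subseteq> E \<Longrightarrow> indep X \<longleftrightarrow> inj_on v X \<and> vec.independent (v ` X)"
    using assms(5) unfolding representable_over_def vecs_def by blast
  have si_sing: "si_indep {e}" if "e \<in> si_ground" for e
    using that loopless si_ground_subset by (auto simp: si_indep_def)
  obtain I where I: "\<forall>i<si.covering_number. si_indep (I i)"
    "si_ground \<subseteq> (\<Union>i<si.covering_number. I i)"
    using si.ex_covering[OF si_sing] by blast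
  have le: "si.covering_number \<le> k" using assms(6) by (simp add: si_covering_number_def)
  \<comment> \<open>The minimal cover may have fewer than \<open>k\<close> members; empty sets pad
    it to \<open>k\<close>.\<close>
  define S where "S i = (if i < si.covering_number then v ` I i else {})" for i
  have S: "vec.independent (S i) \<and> S i \<subseteq> vecs m" for i
  proof (cases "i < si.covering_number")
    case True
    then have "indep (I i)" "I i \<subseteq> E"
      using I(1) indep_subset_ground by (auto simp: si_indep_def)
    then have "vec.independent (v ` I i)" "v ` I i \<subseteq> vecs m"
      using indep_iff v by blast+
    then show ?thesis using True by (simp add: S_def)
  qed (simp add: S_def vec.independent_empty)
  have "\<exists>x\<in>points m. \<forall>i<k. \<forall>w\<in>S i. pairing m w x \<noteq> 0"
    by (rule ex_pairing_neq_0[OF assms(1,3)]) (rule S)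
  then obtain x where x: "x \<in> points m" "\<forall>i<k. \<forall>w\<in>S i. pairing m w x \<noteq> 0" by blast
  have si_nz: "pairing m (v s) x \<noteq> 0" if s: "s \<in> si_ground" for s
  proof -
    obtain i where "i < si.covering_number" "s \<in> I i" using I(2) s by blast
    then have "i < k" "v s \<in> S i" using le by (auto simp: S_def)
    then show ?thesis using x(2) by blast
  qed
  \<comment> \<open>The vector of \<open>e\<close> is a nonzero multiple of that of its class
    representative, so the form at \<open>x\<close> is nonzero at both or at neither.\<close>
  have nz: "pairing m (v e) x \<noteq> 0" if e: "e \<in> E" for e
  proof -
    obtain s where s: "s \<in> si_ground" "(e, s) \<in> parallel" using ex_parallel_si_ground[OF e] .
    have sE: "s \<in> E" using s si_ground_subset by auto
    have "v e \<noteq> 0" using indep_iff[of "{e}"] loopless[OF e] e by auto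
    have vs: "vec.independent {v s}" using indep_iff[of "{s}"] loopless[OF sE] sE by auto
    have "v e \<in> vec.span {v s}"
    \<comment> \<open>If the vectors coincide, \<open>{e, s}\<close> is dependent by failure of
      injectivity alone; otherwise the two distinct vectors are linearly dependent.\<close>
    proof (cases "v e = v s")
      case True
      then show ?thesis using vec.span_base by blast
    next
      case False
      then have "\<not> indep {e, s}" using s(2) by (auto simp: parallel_def)
      then have "\<not> vec.independent {v e, v s}" using False indep_iff[of "{e, s}"] e sE by auto
      then show ?thesis using vs vec.independent_insertI by blast
    qed
    then obtain c where c: "v e = (\<lambda>i. c * v s i)" unfolding vec.span_singleton by (rule rangeE)
    then have "c \<noteq> 0" using \<open>v e \<noteq> 0\<close> by (auto simp: fun_eq_iff)
    then show ?thesis using si_nz[OF s(1)] by (simp add: c pairing_scale)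
  qed
  have "finite (points m :: (nat \<Rightarrow> 'f) set)" by (intro finite_PiE) auto
  then have "card {x \<in> points m. \<forall>e\<in>E. pairing m (v e) x \<noteq> 0} > 0"
    using x(1) nz by (auto simp: card_gt_0_iff)
  moreover have "int (card {x \<in> points m. \<forall>e\<in>E. pairing m (v e) x \<noteq> 0}) =
      int CARD('f) ^ (m - rk E) * poly char_poly (int CARD('f))"
    by (rule representation_char_poly) (fact v, fact indep_iff)
  ultimately have "0 < int CARD('f) ^ (m - rk E) * poly char_poly (int CARD('f))"
    by linarith
  moreover have "0 < int CARD('f) ^ (m - rk E)" by simp
  ultimately have "0 < poly char_poly (int CARD('f))" by (rule zero_less_mult_pos)
  then show ?thesis by (simp only: assms(3))
qed

end
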